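(* Let $\mathcal{X}\subset\mathbb{R}^d$, let $\Sigma\in\mathbb{R}^{d\times d}$ be a covariance matrix, and let $K(\boldsymbol{x},\boldsymbol{x}')=\exp\left(-\tfrac12(\boldsymbol{x}-\boldsymbol{x}')^{\top}\Sigma(\boldsymbol{x}-\boldsymbol{x}')\right)$ be the Gaussian kernel parameterized by $\Sigma$. Let $\Phi$ be the feature map of $K$ on $\mathcal{X}$, i.e. a map from $\mathcal{X}$ into a feature (Hilbert) space with $\langle\Phi(\boldsymbol{x}),\Phi(\boldsymbol{x}')\rangle=K(\boldsymbol{x},\boldsymbol{x}')$ for all $\boldsymbol{x},\boldsymbol{x}'\in\mathcal{X}$. Let $\boldsymbol{e}_1,\dots,\boldsymbol{e}_D\in\mathbb{R}^d$ be samples drawn from $\mathcal{N}(\mathbf{0},I_d)$, and let $\tilde\Phi$ be the random feature map $$\tilde\Phi(\boldsymbol{x})=D^{-1/2}\left[\cos(\boldsymbol{e}_i^{\top}\Sigma^{1/2}\boldsymbol{x}),\ \sin(\boldsymbol{e}_i^{\top}\Sigma^{1/2}\boldsymbol{x})\right]_{i=1}^{D}\in\mathbb{R}^{2D}.$$ Then the following statements hold. (i) The original feature map $\Phi:\mathcal{X}\to\Phi(\mathcal{X})$ is a bijective mapping. (ii) If $\Sigma$ is a non-singular matrix (i.e. a positive definite matrix), $\|\Sigma^{1/2}\|_F\,\mathrm{diam}(\mathcal{X})\,\max_{1\le i\le D}\|\boldsymbol{e}_i\|<2\pi$, and $\mathrm{rank}\{\boldsymbol{e}_1,\dots,\boldsymbol{e}_D\}=d$,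 then the random feature map $\tilde\Phi:\mathcal{X}\to\tilde\Phi(\mathcal{X})$ is a bijection.
   Context: A covariance matrix is a symmetric positive semi-definite matrix; $\Sigma^{1/2}$ is its square root, $\|\cdot\|_F$ is the Frobenius norm, $\|\cdot\|$ is the Euclidean norm, $\mathrm{diam}(\mathcal{X})$ is the diameter of $\mathcal{X}$, i.e. $\sup_{\boldsymbol{x},\boldsymbol{x}'\in\mathcal{X}}\|\boldsymbol{x}-\boldsymbol{x}'\|$, and $\mathrm{rank}\{\boldsymbol{e}_1,\dots,\boldsymbol{e}_D\}$ is the dimension of the linear span of $\boldsymbol{e}_1,\dots,\boldsymbol{e}_D$. The map $\tilde\Phi$ is a finite-dimensional explicit approximation of $\Phi$, in the sense that $\tilde K(\boldsymbol{x},\boldsymbol{x}')=\langle\tilde\Phi(\boldsymbol{x}),\tilde\Phi(\boldsymbol{x}')\rangle$ approximates $K(\boldsymbol{x},\boldsymbol{x}')$.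
   Formalization: Part (i) is stated for non-singular Σ only, as in (ii); for singular Σ it fails: if Σv = 0 with v ≠ 0 and X = {0, v}, then K = 1 on X × X, so Φ(0) = Φ(v). *)

theory Defs
  imports "HOL-Probability.Probability"
begin

definition psd :: "real^'n^'n \<Rightarrow> bool" where
  "psd A \<longleftrightarrow> transpose A = A \<and> (\<forall>x. 0 \<le> x \<bullet> (A *v x))"

text \<open>The square root of a positive semi-definite matrix is the unique positive semi-definite
  matrix squaring to it; the description is meaningful only under \<open>psd A\<close>.\<close>
definition matrix_sqrt :: "real^'n^'n \<Rightarrow> real^'n^'n" where
  "matrix_sqrt A = (THE S. psd S \<and> S ** S = A)"

text \<open>The norm of the type \<open>real^'n^'m\<close> is the Frobenius norm, not the operator norm.\<close>
abbreviation frobenius_norm :: "real^'n^'m \<Rightarrow> real" where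
  "frobenius_norm A \<equiv> norm A"

lemma frobenius_norm_altdef:
  "frobenius_norm (A :: real^'n^'m) = sqrt (\<Sum>i\<in>UNIV. \<Sum>j\<in>UNIV. (A $ i $ j)\<^sup>2)"
  by (simp add: norm_vec_def L2_set_def sum_nonneg)

text \<open>The real-valued \<open>diameter\<close> is unspecified on unbounded sets, so the supremum is taken in the
  extended non-negative reals; the two agree on bounded sets. Products in \<open>ennreal\<close> satisfy
  \<open>0 * \<infinity> = 0\<close>, which is harmless where the other factors are positive.\<close>
definition ediameter :: "'a::metric_space set \<Rightarrow> ennreal" where
  "ediameter X = (SUP x\<in>X. SUP x'\<in>X. ennreal (dist x x'))"

lemma ediameter_eq_diameter:
  assumes "bounded X"
  shows "ediameter X = ennreal (diameter X)"
proof (cases "X = {}")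
  case True
  then show ?thesis by (simp add: ediameter_def diameter_def bot_ennreal)
next
  case False
  show ?thesis
  proof (rule antisym)
    show "ediameter X \<le> ennreal (diameter X)"
      unfolding ediameter_def
      by (intro SUP_least ennreal_leI diameter_bounded_bound[OF assms])
    show "ennreal (diameter X) \<le> ediameter X"
    proof (rule ccontr)
      assume "\<not> ?thesis"
      then have lt: "ediameter X < ennreal (diameter X)" by simp
      then obtain r where r: "ediameter X = ennreal r" "0 \<le> r"
        by (cases "ediameter X") auto
      have "dist x y \<le> r" if "x \<in> X" "y \<in> X" for x y
      proof -
        have "ennreal (dist x y) \<le> ediameter X"
          unfolding ediameter_def using that by (meson SUP_upper2 order_refl)
        then show ?thesis using r by simp
      qed
      then have "diameter X \<le> r"
        using False by (auto simp: diameter_def intro!: cSUP_least)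
      then show False using lt r by (simp add: ennreal_less_iff)
    qed
  qed
qed

definition gaussian_kernel :: "real^'d^'d \<Rightarrow> real^'d \<Rightarrow> real^'d \<Rightarrow> real" where
  "gaussian_kernel \<Sigma> x x' = exp (- (1/2) * ((x - x') \<bullet> (\<Sigma> *v (x - x'))))"

definition is_feature_map ::
    "('a \<Rightarrow> 'a \<Rightarrow> real) \<Rightarrow> 'a set \<Rightarrow> ('a \<Rightarrow> 'h::{real_inner,complete_space}) \<Rightarrow> bool" where
  "is_feature_map K X \<Phi> \<longleftrightarrow> (\<forall>x\<in>X. \<forall>x'\<in>X. \<Phi> x \<bullet> \<Phi> x' = K x x')"

definition std_gaussian_density :: "real^'d \<Rightarrow> real" where
  "std_gaussian_density x = (2 * pi) powr (- real CARD('d) / 2) * exp (- (norm x)\<^sup>2 / 2)"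

text \<open>The sample size \<open>D\<close> is \<open>CARD('D)\<close> and \<open>\<real>\<^sup>2\<^sup>D\<close> is \<open>real^('D + 'D)\<close>: coordinate \<open>Inl i\<close> is
  the cosine and \<open>Inr i\<close> the sine belonging to the sample \<open>e i\<close>.\<close>
definition random_feature_map ::
    "real^'d^'d \<Rightarrow> ('D::finite \<Rightarrow> real^'d) \<Rightarrow> real^'d \<Rightarrow> real^('D + 'D)" where
  "random_feature_map \<Sigma> e x = real CARD('D) powr (- 1/2) *\<^sub>R
     (\<chi> k. case k of Inl i \<Rightarrow> cos (e i \<bullet> (matrix_sqrt \<Sigma> *v x))
                   | Inr i \<Rightarrow> sin (e i \<bullet> (matrix_sqrt \<Sigma> *v x)))"

end

theory Submission
  imports Defs
begin

text \<open>Both maps are injective because \<open>\<Sigma>\<^sup>1\<^sup>/\<^sup>2\<close> is. For \<open>\<Phi>\<close>: if \<open>\<Phi> x = \<Phi> y\<close> then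
  \<open>K(x, y) = K(x, x) = 1\<close>, so the quadratic form of \<open>\<Sigma>\<close> vanishes at \<open>x - y\<close>. For the random
  features: equal cosines and sines force every \<open>e\<^sub>i \<bullet> \<Sigma>\<^sup>1\<^sup>/\<^sup>2 (x - y)\<close> to be a multiple of \<open>2\<pi>\<close>;
  by Cauchy-Schwarz the diameter hypothesis leaves only \<open>0\<close>, and since the \<open>e\<^sub>i\<close> span,
  \<open>\<Sigma>\<^sup>1\<^sup>/\<^sup>2 (x - y) = 0\<close>. That the description defining \<open>matrix_sqrt\<close> denotes a square root rests on
  the spectral theorem, obtained by maximising the Rayleigh quotient on invariant subspaces.\<close>

section \<open>Spectral theorem\<close>

text \<open>A maximiser \<open>v\<close> of the Rayleigh quotient on the unit sphere of
  \<open>S\<close> is an eigenvector: the form \<open>q\<close> below is nonnegative on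
  \<open>S\<close> and vanishes at \<open>v\<close>, so its first-order variation at
  \<open>v\<close> must vanish.\<close>

lemma self_adjoint_eigenvector_in_subspace:
  fixes f :: "'a::euclidean_space \<Rightarrow> 'a"
  assumes lin: "linear f" and sa: "\<And>x y. x \<bullet> f y = f x \<bullet> y"
    and S: "subspace S" and inv: "f ` S \<subseteq> S" and nz: "S \<noteq> {0}"
  obtains v c where "v \<in> S" "norm v = 1" "f v = c *\<^sub>R v"
proof -
  obtain x where x: "x \<in> S" "x \<noteq> 0"
    using nz subspace_0[OF S] by blast
  have "compact (S \<inter> sphere 0 1)"
    using closed_subspace[OF S] by (simp add: closed_Int_compact)
  moreover have "sgn x \<in> S \<inter> sphere 0 1"
    using x S by (simp add: sgn_div_norm subspace_scale)
  then have "S \<inter> sphere 0 1 \<noteq> {}" by blast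
  moreover have "continuous_on (S \<inter> sphere 0 1) (\<lambda>v. v \<bullet> f v)"
    using lin by (intro continuous_intros linear_continuous_on) (simp add: linear_conv_bounded_linear)
  ultimately obtain v where v: "v \<in> S \<inter> sphere 0 1"
    and max: "\<And>w. w \<in> S \<inter> sphere 0 1 \<Longrightarrow> w \<bullet> f w \<le> v \<bullet> f v"
    by (metis continuous_attains_sup)
  define c where "c = v \<bullet> f v"
  define q where "q w = c * (w \<bullet> w) - w \<bullet> f w" for w
  \<comment> \<open>Homogeneity of degree 2 carries maximality from the unit sphere to all of
    \<open>S\<close>.\<close>
  have q_nonneg: "0 \<le> q w" if "w \<in> S" for w
  proof (cases "w = 0")
    case False
    have "sgn w \<in> S \<inter> sphere 0 1"
      using that False S by (simp add: sgn_div_norm subspace_scale)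
    then have "sgn w \<bullet> f (sgn w) \<le> c"
      unfolding c_def by (rule max)
    moreover have "sgn w \<bullet> f (sgn w) = (w \<bullet> f w) / (w \<bullet> w)"
      by (simp add: sgn_div_norm linear_scale[OF lin] divide_simps dot_square_norm power2_eq_square)
    moreover have "0 < w \<bullet> w" using False by simp
    ultimately show ?thesis
      by (simp add: q_def pos_divide_le_eq)
  qed (simp add: q_def)
  \<comment> \<open>Half the gradient of \<open>q\<close> at \<open>v\<close>; invariance of
    \<open>S\<close> keeps it in \<open>S\<close>, so \<open>q\<close> can be tested along
    it.\<close>
  define u where "u = c *\<^sub>R v - f v"
  have u: "u \<in> S"
    using v inv S by (auto simp: u_def intro!: subspace_diff subspace_scale)
  have vv: "v \<bullet> v = 1" using v by (simp add: dot_square_norm)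
  have expand: "q (v - t *\<^sub>R u) = t\<^sup>2 * q u - 2 * t * (u \<bullet> u)" for t
  proof -
    have uu: "u \<bullet> u = c * (u \<bullet> v) - u \<bullet> f v"
      by (subst (2) u_def) (simp add: inner_diff_right)
    have "v \<bullet> f u = u \<bullet> f v"
      by (subst sa) (rule inner_commute)
    then show ?thesis
      unfolding uu
      by (simp add: q_def linear_diff[OF lin] linear_scale[OF lin] inner_diff_left inner_diff_right
          vv c_def[symmetric] inner_commute[of v u] power2_eq_square algebra_simps)
  qed
  have "u \<bullet> u = 0"
  proof (rule ccontr)
    assume "u \<bullet> u \<noteq> 0"
    then have pos: "0 < u \<bullet> u" by (simp add: order_less_le)
    have qu: "0 \<le> q u" using u by (rule q_nonneg)
    \<comment> \<open>A step short enough that the linear term of \<open>expand\<close> dominates;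
      the \<open>+ 1\<close> guards against \<open>q u = 0\<close>.\<close>
    define t where "t = (u \<bullet> u) / (q u + 1)"
    have t: "0 < t" using pos qu by (simp add: t_def)
    have "0 \<le> q (v - t *\<^sub>R u)"
      using v u S by (intro q_nonneg subspace_diff subspace_scale) auto
    then have "0 \<le> t * (t * q u - 2 * (u \<bullet> u))"
      by (simp add: expand power2_eq_square algebra_simps)
    then have "2 * (u \<bullet> u) \<le> t * q u"
      using t by (simp add: zero_le_mult_iff)
    also have "\<dots> \<le> t * (q u + 1)" using t by simp
    also have "\<dots> = u \<bullet> u" using qu by (simp add: t_def)
    finally show False using pos by simp
  qed
  then have "f v = c *\<^sub>R v" by (simp add: u_def)
  then show thesis using that v by auto
qed

text \<open>An orthonormal set of eigenvectors of greatest cardinality spans: otherwise its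
  orthogonal complement is a nonzero invariant subspace, which supplies one more
  eigenvector.\<close>

theorem self_adjoint_eigenbasis:
  fixes f :: "'a::euclidean_space \<Rightarrow> 'a"
  assumes lin: "linear f" and sa: "\<And>x y. x \<bullet> f y = f x \<bullet> y"
  obtains B c where "finite B" "pairwise orthogonal B" "span B = UNIV"
    "\<And>b. b \<in> B \<Longrightarrow> norm b = 1" "\<And>b. b \<in> B \<Longrightarrow> f b = c b *\<^sub>R b"
proof -
  define P where "P B \<longleftrightarrow> pairwise orthogonal B \<and> (\<forall>b\<in>B. norm b = 1 \<and> (\<exists>c. f b = c *\<^sub>R b))"
    for B
  have bound: "finite B \<and> card B \<le> DIM('a)" if "P B" for B
  proof -
    have "0 \<notin> B" using that by (auto simp: P_def)
    then have "independent B"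
      using that by (intro pairwise_orthogonal_independent) (auto simp: P_def)
    then show ?thesis by (rule independent_bound)
  qed
  have "P {}" by (simp add: P_def)
  then obtain B where B: "P B" and maximal: "\<And>C. P C \<Longrightarrow> card C \<le> card B"
    using ex_has_greatest_nat[of P "{}" card "Suc DIM('a)"] bound by (auto simp: le_imp_less_Suc)
  define S where "S = {x. \<forall>b\<in>B. orthogonal b x}"
  have S: "subspace S"
    by (auto simp: S_def subspace_def orthogonal_clauses)
  have "S = {0}"
  proof (rule ccontr)
    assume "S \<noteq> {0}"
    \<comment> \<open>If \<open>b\<close> is an eigenvector orthogonal to \<open>x\<close>, then
      \<open>b \<bullet> f x = f b \<bullet> x\<close> is a multiple of
      \<open>b \<bullet> x = 0\<close>.\<close>
    moreover have "f ` S \<subseteq> S"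
      using B by (auto simp: S_def P_def orthogonal_def sa)
    ultimately obtain v k where v: "v \<in> S" "norm v = 1" "f v = k *\<^sub>R v"
      using self_adjoint_eigenvector_in_subspace[OF lin sa S] by blast
    have "v \<notin> B" using v by (auto simp: S_def orthogonal_def)
    moreover have "P (insert v B)"
      using B v by (auto simp: P_def S_def pairwise_insert orthogonal_commute)
    ultimately show False
      using maximal[of "insert v B"] bound[OF B] by simp
  qed
  have "span B = UNIV"
  proof (rule ccontr)
    assume "span B \<noteq> UNIV"
    then have "span B \<subset> span UNIV" by auto
    then obtain x where x: "x \<noteq> 0" "\<And>y. y \<in> span B \<Longrightarrow> orthogonal x y"
      by (metis orthogonal_to_subspace_exists_gen)
    then have "x \<in> S"
      by (auto simp: S_def orthogonal_commute span_base)
    then show False using x \<open>S = {0}\<close> by simp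
  qed
  moreover obtain c where "\<And>b. b \<in> B \<Longrightarrow> f b = c b *\<^sub>R b"
    using B unfolding P_def by metis
  ultimately show thesis
    using that B bound[OF B] unfolding P_def by blast
qed

section \<open>Square roots of positive semi-definite matrices\<close>

lemma psd_inner_commute:
  assumes "psd A"
  shows "x \<bullet> (A *v y) = (A *v x) \<bullet> y"
  using assms by (metis dot_lmul_matrix psd_def transpose_matrix_vector)

lemma psd_eigenvalue_nonneg:
  assumes "psd A" "A *v b = c *\<^sub>R b" "norm b = 1"
  shows "0 \<le> c"
proof -
  have "0 \<le> b \<bullet> (A *v b)" using assms(1) by (simp add: psd_def)
  then show ?thesis using assms by (simp add: dot_square_norm)
qed

lemma psd_eigenbasis:
  fixes A :: "real^'n^'n"
  assumes "psd A"
  obtains B c where "finite B" "pairwise orthogonal B" "span B = UNIV"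
    "\<And>b. b \<in> B \<Longrightarrow> norm b = 1" "\<And>b. b \<in> B \<Longrightarrow> A *v b = c b *\<^sub>R b"
    "\<And>b. b \<in> B \<Longrightarrow> 0 \<le> c b"
proof (rule self_adjoint_eigenbasis[of "(*v) A"])
  show "linear ((*v) A)" by simp
  show "x \<bullet> (A *v y) = (A *v x) \<bullet> y" for x y
    using assms by (rule psd_inner_commute)
qed (use assms psd_eigenvalue_nonneg that in blast)

text \<open>In an orthonormal eigenbasis of \<open>A\<close>, the root scales each basis vector by
  the square root of its eigenvalue; \<open>T \<circ> T\<close> and \<open>A\<close> then agree on a
  spanning set.\<close>

lemma psd_sqrt_exists:
  fixes A :: "real^'n^'n"
  assumes "psd A"
  obtains S where "psd S" "S ** S = A"
proof -
  obtain B c where B: "finite B" "pairwise orthogonal B" "span B = UNIV"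
    and unit: "\<And>b. b \<in> B \<Longrightarrow> norm b = 1" and eig: "\<And>b. b \<in> B \<Longrightarrow> A *v b = c b *\<^sub>R b"
    and c: "\<And>b. b \<in> B \<Longrightarrow> 0 \<le> c b"
    by (rule psd_eigenbasis[OF assms]) blast
  define T where "T x = (\<Sum>b\<in>B. (sqrt (c b) * (b \<bullet> x)) *\<^sub>R b)" for x
  have lin: "linear T"
    by (rule linearI)
      (simp_all add: T_def inner_add_right algebra_simps sum.distrib scaleR_sum_right)
  have T_eig: "T b = sqrt (c b) *\<^sub>R b" if "b \<in> B" for b
  proof -
    have "T b = (\<Sum>d\<in>B. if d = b then sqrt (c b) *\<^sub>R b else 0)"
      unfolding T_def using B(2) that unit
      by (intro sum.cong) (auto simp: pairwise_def orthogonal_def dot_square_norm)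
    then show ?thesis using B(1) that by simp
  qed
  have T_inner: "x \<bullet> T y = (\<Sum>b\<in>B. sqrt (c b) * (b \<bullet> x) * (b \<bullet> y))" for x y
    by (simp add: T_def inner_sum_right inner_commute[of x] ac_simps)
  have sa: "x \<bullet> T y = T x \<bullet> y" for x y
    by (subst inner_commute[of "T x"]) (simp add: T_inner ac_simps)
  have mult: "matrix T *v x = T x" for x
    using lin by (simp add: matrix_works linear_def scalar_mult_eq_scaleR)
  have "adjoint T = T"
    using sa by (intro adjoint_unique) simp
  then have "transpose (matrix T) = matrix T"
    using matrix_adjoint[OF lin] by simp
  moreover have "0 \<le> x \<bullet> T x" for x
    unfolding T_inner using c by (intro sum_nonneg) (simp add: mult.assoc)
  ultimately have "psd (matrix T)"
    by (simp add: psd_def mult)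
  moreover have "(T \<circ> T) x = A *v x" for x
  proof (rule linear_eq_on_span[of "T \<circ> T" "(*v) A" B])
    show "linear (T \<circ> T)" using lin lin by (rule linear_compose)
    show "(T \<circ> T) b = A *v b" if "b \<in> B" for b
      using that c by (simp add: T_eig eig linear_scale[OF lin])
  qed (simp_all add: B)
  then have "matrix T ** matrix T = A"
    by (simp add: matrix_eq mult flip: matrix_vector_mul_assoc)
  ultimately show thesis by (rule that)
qed

text \<open>On an eigenvector of \<open>S\<close> with eigenvalue \<open>c > 0\<close>, \<open>(T + c) (T - c) = 0\<close> and \<open>T + c\<close> is
  injective.\<close>
lemma psd_sqrt_unique:
  fixes S T :: "real^'n^'n"
  assumes S: "psd S" and T: "psd T" and eq: "S ** S = T ** T"
  shows "S = T"
proof -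
  obtain B c where B: "finite B" "pairwise orthogonal B" "span B = UNIV"
    and unit: "\<And>b. b \<in> B \<Longrightarrow> norm b = 1" and eig: "\<And>b. b \<in> B \<Longrightarrow> S *v b = c b *\<^sub>R b"
    and c: "\<And>b. b \<in> B \<Longrightarrow> 0 \<le> c b"
    by (rule psd_eigenbasis[OF S]) blast
  have agree: "S *v b = T *v b" if b: "b \<in> B" for b
  proof -
    have sq: "T *v (T *v b) = (c b * c b) *\<^sub>R b"
      using eig[OF b] eq by (metis matrix_vector_mul_assoc matrix_vector_mult_scaleR scaleR_scaleR)
    show ?thesis
    proof (cases "c b = 0")
      case True
      \<comment> \<open>For eigenvalue 0 the right-hand side vanishes, hence so does
        \<open>T *v b\<close>.\<close>
      have "(T *v b) \<bullet> (T *v b) = b \<bullet> (T *v (T *v b))"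
        by (simp add: psd_inner_commute[OF T])
      then show ?thesis using True sq eig[OF b] by simp
    next
      case False
      then have pos: "0 < c b" using c[OF b] by simp
      define w where "w = T *v b - c b *\<^sub>R b"
      \<comment> \<open>A nonzero \<open>w\<close> would be an eigenvector of \<open>T\<close> with
        negative eigenvalue, contradicting \<open>psd T\<close>.\<close>
      have "T *v w = - (c b *\<^sub>R w)"
        by (simp add: w_def sq matrix_vector_mult_diff_distrib matrix_vector_mult_scaleR
            scaleR_diff_right)
      moreover have "0 \<le> w \<bullet> (T *v w)" using T by (simp add: psd_def)
      ultimately have "c b * (w \<bullet> w) \<le> 0" by simp
      then have "w \<bullet> w \<le> 0" using pos by (simp add: mult_le_0_iff)
      then have "w = 0" using inner_gt_zero_iff[of w] by linarith
      then show ?thesis by (simp add: w_def eig[OF b])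
    qed
  qed
  have "S *v x = T *v x" for x
    by (rule linear_eq_on_span[of "(*v) S" "(*v) T" B]) (simp_all add: B agree)
  then show ?thesis by (simp add: matrix_eq)
qed

text \<open>Existence and uniqueness make the description denote; later proofs use the root only
  through these two facts and linearity.\<close>

lemma matrix_sqrt:
  assumes "psd A"
  shows psd_matrix_sqrt: "psd (matrix_sqrt A)"
    and matrix_sqrt_mult_self: "matrix_sqrt A ** matrix_sqrt A = A"
proof -
  have "\<exists>!S. psd S \<and> S ** S = A"
    using psd_sqrt_exists[OF assms] psd_sqrt_unique by metis
  from theI'[OF this] show "psd (matrix_sqrt A)" "matrix_sqrt A ** matrix_sqrt A = A"
    by (simp_all add: matrix_sqrt_def)
qed

lemma matrix_sqrt_eq_0_imp:
  assumes "psd A" "invertible A" "matrix_sqrt A *v x = 0"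
  shows "x = 0"
proof -
  have "A *v x = matrix_sqrt A *v (matrix_sqrt A *v x)"
    using matrix_sqrt_mult_self[OF assms(1)] by (simp add: matrix_vector_mul_assoc)
  then have "A *v x = 0" using assms(3) by simp
  then show ?thesis
    using assms(2) matrix_left_invertible_ker[of A] unfolding invertible_def by blast
qed

text \<open>One symmetric factor of the root moves across the inner product. This turns the exponent
  of the kernel into a squared norm.\<close>

lemma inner_psd_eq_norm_sqrt:
  assumes "psd A"
  shows "x \<bullet> (A *v x) = (norm (matrix_sqrt A *v x))\<^sup>2"
proof -
  have "x \<bullet> (A *v x) = x \<bullet> (matrix_sqrt A *v (matrix_sqrt A *v x))"
    using matrix_sqrt_mult_self[OF assms] by (simp add: matrix_vector_mul_assoc)
  then show ?thesis
    by (simp add: psd_inner_commute[OF psd_matrix_sqrt[OF assms]] dot_square_norm)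
qed

text \<open>Cauchy-Schwarz applied to each row, then summed in squares.\<close>

lemma norm_matrix_vector_mult_le:
  fixes A :: "real^'n^'m"
  shows "norm (A *v x) \<le> frobenius_norm A * norm x"
proof -
  have "norm (A *v x) = L2_set (\<lambda>i. norm ((A *v x) $ i)) UNIV"
    by (simp add: norm_vec_def)
  also have "\<dots> \<le> L2_set (\<lambda>i. norm (A $ i) * norm x) UNIV"
    by (intro L2_set_mono) (simp_all add: matrix_mult_dot Cauchy_Schwarz_ineq2)
  also have "\<dots> = frobenius_norm A * norm x"
    by (simp add: norm_vec_def[of A] L2_set_left_distrib)
  finally show ?thesis .
qed

section \<open>Injectivity of the feature maps\<close>

lemma inj_on_feature_map:
  assumes \<Sigma>: "psd \<Sigma>" "invertible \<Sigma>" and feature: "is_feature_map (gaussian_kernel \<Sigma>) X \<Phi>"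
  shows "inj_on \<Phi> X"
proof (rule inj_onI)
  fix x y assume xy: "x \<in> X" "y \<in> X" "\<Phi> x = \<Phi> y"
  have "gaussian_kernel \<Sigma> x y = gaussian_kernel \<Sigma> x x"
    using feature xy unfolding is_feature_map_def by metis
  then have "matrix_sqrt \<Sigma> *v (x - y) = 0"
    using inner_psd_eq_norm_sqrt[OF \<Sigma>(1), of "x - y"] by (simp add: gaussian_kernel_def)
  then show "x = y"
    using matrix_sqrt_eq_0_imp[OF \<Sigma>] by (metis eq_iff_diff_eq_0)
qed

lemma inner_eq_0_if_random_feature_map_eq:
  fixes e :: "'D::finite \<Rightarrow> real^'d"
  assumes eq: "random_feature_map \<Sigma> e x = random_feature_map \<Sigma> e y"
    and small: "\<bar>e i \<bullet> (matrix_sqrt \<Sigma> *v (x - y))\<bar> < 2 * pi"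
  shows "e i \<bullet> (matrix_sqrt \<Sigma> *v (x - y)) = 0"
proof -
  let ?a = "\<lambda>x. e i \<bullet> (matrix_sqrt \<Sigma> *v x)"
  \<comment> \<open>Index types are nonempty, so the normalising factor can be cancelled.\<close>
  have D: "real CARD('D) powr (- 1/2) \<noteq> 0" by simp
  have "random_feature_map \<Sigma> e x $ Inl i = random_feature_map \<Sigma> e y $ Inl i"
    "random_feature_map \<Sigma> e x $ Inr i = random_feature_map \<Sigma> e y $ Inr i"
    using eq by simp_all
  then have "sin (?a x) = sin (?a y) \<and> cos (?a x) = cos (?a y)"
    using D by (simp add: random_feature_map_def)
  then obtain n :: int where n: "?a x = ?a y + 2 * pi * n"
    using sin_cos_eq_iff by blast
  then have diff: "?a (x - y) = 2 * pi * n"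
    by (simp add: matrix_vector_mult_diff_distrib inner_diff_right)
  \<comment> \<open>The angles differ by less than one full period, which leaves only
    \<open>n = 0\<close>.\<close>
  then have "2 * pi * \<bar>real_of_int n\<bar> < 2 * pi * 1"
    using small by (simp add: abs_mult)
  then have "\<bar>real_of_int n\<bar> < 1"
    by (subst (asm) mult_less_cancel_left_pos) simp_all
  then have "n = 0" by linarith
  then show ?thesis using diff by simp
qed

lemma dist_le_ediameter:
  assumes "x \<in> X" "y \<in> X"
  shows "ennreal (dist x y) \<le> ediameter X"
  unfolding ediameter_def using assms by (meson SUP_upper2 order_refl)

lemma inj_on_random_feature_map:
  fixes e :: "'D::finite \<Rightarrow> real^'d"
  assumes \<Sigma>: "psd \<Sigma>" "invertible \<Sigma>"
    and small: "ennreal (frobenius_norm (matrix_sqrt \<Sigma>)) * ediameter X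
      * ennreal (Max (range (\<lambda>i. norm (e i)))) < ennreal (2 * pi)"
    and rank: "dim (span (range e)) = CARD('d)"
  shows "inj_on (random_feature_map \<Sigma> e) X"
proof (rule inj_onI)
  fix x y assume x: "x \<in> X" and y: "y \<in> X"
    and eq: "random_feature_map \<Sigma> e x = random_feature_map \<Sigma> e y"
  let ?z = "matrix_sqrt \<Sigma> *v (x - y)"
  have orth: "e i \<bullet> ?z = 0" for i
  proof (rule inner_eq_0_if_random_feature_map_eq[OF eq])
    have "\<bar>e i \<bullet> ?z\<bar> \<le> norm (e i) * norm ?z"
      by (rule Cauchy_Schwarz_ineq2)
    also have "\<dots> \<le> norm (e i) * (norm (matrix_sqrt \<Sigma>) * dist x y)"
      by (intro mult_left_mono) (simp_all add: norm_matrix_vector_mult_le dist_norm)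
    \<comment> \<open>The real bound is lifted to \<open>ennreal\<close> because
      \<open>ediameter X\<close> is not known to be finite.\<close>
    finally have "ennreal \<bar>e i \<bullet> ?z\<bar> \<le>
        ennreal (norm (matrix_sqrt \<Sigma>)) * ennreal (dist x y) * ennreal (norm (e i))"
      by (simp add: ennreal_mult[symmetric] ennreal_leI ac_simps)
    also have "\<dots> \<le> ennreal (norm (matrix_sqrt \<Sigma>)) * ediameter X
        * ennreal (Max (range (\<lambda>i. norm (e i))))"
      by (intro mult_mono ennreal_leI dist_le_ediameter x y) auto
    also note small
    finally show "\<bar>e i \<bullet> ?z\<bar> < 2 * pi"
      by (simp add: ennreal_less_iff)
  qed
  have "span (range e) = UNIV"
    using rank dim_eq_full[of "range e"] by simp
  \<comment> \<open>Being orthogonal to every \<open>e i\<close> and in their span,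
    \<open>?z\<close> is orthogonal to itself.\<close>
  then have "?z \<in> span (range e)" by simp
  then have "orthogonal ?z ?z"
    by (rule orthogonal_to_span) (auto simp: orthogonal_def inner_commute orth)
  then have "?z = 0" by (simp add: orthogonal_def)
  then show "x = y"
    using matrix_sqrt_eq_0_imp[OF \<Sigma>] by (metis eq_iff_diff_eq_0)
qed

text \<open>The first claim carries \<open>invertible \<Sigma>\<close> because, for singular
  \<Sigma>, two points of \<open>X\<close> differing by a kernel vector have kernel value 1 and
  hence the same image under \<Phi>. Every map is onto its image, so both claims reduce to
  injectivity, the second one for each fixed outcome.\<close>

theorem theorem3:
  fixes X :: "(real^'d) set"
    and \<Sigma> :: "real^'d^'d"
    and \<Phi> :: "real^'d \<Rightarrow> 'h::{real_inner,complete_space}"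
    and M :: "'w measure"
    and e :: "'D::finite \<Rightarrow> 'w \<Rightarrow> real^'d"
  assumes covariance: "psd \<Sigma>"
    and feature: "is_feature_map (gaussian_kernel \<Sigma>) X \<Phi>"
    and prob: "prob_space M"
    and normal: "\<And>i. distributed M lborel (e i) (\<lambda>x. ennreal (std_gaussian_density x))"
    and indep: "prob_space.indep_vars M (\<lambda>_. borel) e UNIV"
  shows "(invertible \<Sigma> \<longrightarrow> bij_betw \<Phi> X (\<Phi> ` X)) \<and>
    (\<forall>\<omega>\<in>space M.
       invertible \<Sigma> \<and>
       ennreal (frobenius_norm (matrix_sqrt \<Sigma>)) * ediameter X
         * ennreal (Max (range (\<lambda>i. norm (e i \<omega>)))) < ennreal (2 * pi) \<and>
       dim (span (range (\<lambda>i. e i \<omega>))) = CARD('d)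
       \<longrightarrow> bij_betw (random_feature_map \<Sigma> (\<lambda>i. e i \<omega>)) X
             (random_feature_map \<Sigma> (\<lambda>i. e i \<omega>) ` X))"
proof (intro conjI impI ballI; (elim conjE)?; rule inj_on_imp_bij_betw)
  assume "invertible \<Sigma>"
  then show "inj_on \<Phi> X"
    using inj_on_feature_map covariance feature by blast
qed (rule inj_on_random_feature_map[OF covariance])

end
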